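(* Suppose $A\subseteq 2^\omega$ is a Turing independent set of reals which contains a perfect set $A'$, $B$ is a countable dense subset of $A'$, and $x\in 2^\omega$ computes every element of $B$. Then $(A\setminus B)\cup\{x\}$ is not Turing independent.
   Context: A set $A\subseteq 2^\omega$ is Turing independent if whenever $a_0,\ldots,a_n\in A$ and $b\in A$ is not equal to any $a_i$, then $a_0\oplus\cdots\oplus a_n$ does not compute $b$ (i.e. $b\not\leq_T a_0\oplus\cdots\oplus a_n$). A perfect set is a nonempty closed subset of $2^\omega$ with no isolated points; "dense subset of $A'$" refers to the subspace topology on $A'$. *)

theory Defs
  imports Main "HOL-Library.Countable_Set"
begin

datatype recf =
    Z
  | S
  | Id nat
  | Comp recf "recf list"
  | Pr recf recf
  | Mn recf
  | Orc

inductive oeval :: "(nat \<Rightarrow> bool) \<Rightarrow> recf \<Rightarrow> nat list \<Rightarrow> nat \<Rightarrow> bool" for X where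
  zero: "oeval X Z xs 0"
| succ: "oeval X S (x # xs) (Suc x)"
| proj: "i < length xs \<Longrightarrow> oeval X (Id i) xs (xs ! i)"
| comp: "list_all2 (\<lambda>g y. oeval X g xs y) gs ys \<Longrightarrow> oeval X f ys v \<Longrightarrow> oeval X (Comp f gs) xs v"
| pr0: "oeval X f xs v \<Longrightarrow> oeval X (Pr f g) (0 # xs) v"
| prS: "oeval X (Pr f g) (n # xs) r \<Longrightarrow> oeval X g (r # n # xs) v \<Longrightarrow> oeval X (Pr f g) (Suc n # xs) v"
| mn: "oeval X f (v # xs) 0 \<Longrightarrow> (\<forall>u<v. \<exists>r. oeval X f (u # xs) r \<and> r \<noteq> 0) \<Longrightarrow> oeval X (Mn f) xs v"
| orc: "oeval X Orc (n # xs) (if X n then 1 else 0)"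

definition turing_le :: "(nat \<Rightarrow> bool) \<Rightarrow> (nat \<Rightarrow> bool) \<Rightarrow> bool" where
  "turing_le b X \<longleftrightarrow> (\<exists>p. \<forall>n. oeval X p [n] (if b n then 1 else 0))"

definition join :: "(nat \<Rightarrow> bool) list \<Rightarrow> (nat \<Rightarrow> bool)" where
  "join as = (\<lambda>k. (as ! (k mod length as)) (k div length as))"

definition turing_independent :: "(nat \<Rightarrow> bool) set \<Rightarrow> bool" where
  "turing_independent A \<longleftrightarrow>
     (\<forall>as b. as \<noteq> [] \<and> set as \<subseteq> A \<and> b \<in> A \<and> b \<notin> set as \<longrightarrow> \<not> turing_le b (join as))"

text \<open>Cantor space topology (product topology), via initial segments.\<close>
definition agree_upto :: "nat \<Rightarrow> (nat \<Rightarrow> bool) \<Rightarrow> (nat \<Rightarrow> bool) \<Rightarrow> bool" where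
  "agree_upto n x y \<longleftrightarrow> (\<forall>i<n. x i = y i)"

definition cantor_closed :: "(nat \<Rightarrow> bool) set \<Rightarrow> bool" where
  "cantor_closed C \<longleftrightarrow> (\<forall>x. (\<forall>n. \<exists>y\<in>C. agree_upto n x y) \<longrightarrow> x \<in> C)"

definition perfect_set :: "(nat \<Rightarrow> bool) set \<Rightarrow> bool" where
  "perfect_set C \<longleftrightarrow> C \<noteq> {} \<and> cantor_closed C \<and>
     (\<forall>x\<in>C. \<forall>n. \<exists>y\<in>C. y \<noteq> x \<and> agree_upto n x y)"

definition dense_in :: "(nat \<Rightarrow> bool) set \<Rightarrow> (nat \<Rightarrow> bool) set \<Rightarrow> bool" where
  "dense_in D C \<longleftrightarrow> D \<subseteq> C \<and> (\<forall>x\<in>C. \<forall>n. \<exists>y\<in>D. agree_upto n x y)"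

end

theory Submission
  imports Defs "HOL-Library.Nat_Bijection"
begin

text \<open>A real \<open>y \<in> A' - B\<close> different from \<open>x\<close> is coded into six reals of \<open>A'\<close>, arranged in two triples,
  that together with \<open>x\<close> compute it. In a triple, the reals take turns: at stage \<open>t\<close> one of them
  leaves the element \<open>p t\<close> of \<open>B\<close> it has been following and switches to another
  element \<open>p (t + 3)\<close> of \<open>B\<close>, the first disagreement being at a position \<open>d t\<close>. Density
  allows \<open>d t\<close> to be arbitrarily large, although not to be chosen exactly. We take it so large that
  it bounds an index, relative to \<open>x\<close>, of a program for \<open>p (t + 2)\<close>, and that every wrong program
  for \<open>p (t + 1)\<close> with index at most \<open>d (t - 1)\<close> fails below \<open>d t\<close>. Then \<open>d (t + 2)\<close> can be
  computed from \<open>d t\<close> and \<open>d (t + 1)\<close> with a universal machine, so \<open>d\<close> is computable from \<open>x\<close> and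
  the triple. The two triples are built simultaneously such that \<open>y t\<close> holds iff the first
  triple disagrees earlier than the second one at stage \<open>t\<close>.\<close>

subsection \<open>Functions computable in an oracle\<close>

definition pair :: "nat \<Rightarrow> nat \<Rightarrow> nat" where
  "pair a b = prod_encode (a, b)"

definition p1 :: "nat \<Rightarrow> nat" where
  "p1 n = fst (prod_decode n)"

definition p2 :: "nat \<Rightarrow> nat" where
  "p2 n = snd (prod_decode n)"

lemma p1_pair [simp]: "p1 (pair a b) = a"
  by (simp add: p1_def pair_def)

lemma p2_pair [simp]: "p2 (pair a b) = b"
  by (simp add: p2_def pair_def)

lemma pair_p1_p2 [simp]: "pair (p1 n) (p2 n) = n"
  by (simp add: p1_def p2_def pair_def)

definition rec_in :: "(nat \<Rightarrow> bool) \<Rightarrow> (nat \<Rightarrow> nat) \<Rightarrow> bool" where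
  "rec_in X f \<longleftrightarrow> (\<exists>p. \<forall>n. oeval X p [n] (f n))"

definition rec2_in :: "(nat \<Rightarrow> bool) \<Rightarrow> (nat \<Rightarrow> nat \<Rightarrow> nat) \<Rightarrow> bool" where
  "rec2_in X f \<longleftrightarrow> (\<exists>p. \<forall>a b. oeval X p [a, b] (f a b))"

definition rec3_in :: "(nat \<Rightarrow> bool) \<Rightarrow> (nat \<Rightarrow> nat \<Rightarrow> nat \<Rightarrow> nat) \<Rightarrow> bool" where
  "rec3_in X f \<longleftrightarrow> (\<exists>p. \<forall>a b c. oeval X p [a, b, c] (f a b c))"

lemma oeval_proj: "i < length xs \<Longrightarrow> v = xs ! i \<Longrightarrow> oeval X (Id i) xs v"
  by (simp add: oeval.proj)

lemma oeval_comp1: "oeval X g xs y \<Longrightarrow> oeval X f [y] v \<Longrightarrow> oeval X (Comp f [g]) xs v"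
  by (rule oeval.comp[where ys = "[y]"]) auto

lemma oeval_comp2:
  "oeval X g xs y \<Longrightarrow> oeval X h xs z \<Longrightarrow> oeval X f [y, z] v \<Longrightarrow> oeval X (Comp f [g, h]) xs v"
  by (rule oeval.comp[where ys = "[y, z]"]) auto

lemma rec_id: "rec_in X (\<lambda>n. n)"
  unfolding rec_in_def by (rule exI[of _ "Id 0"]) (auto intro: oeval_proj)

lemma rec_Suc: assumes "rec_in X f" shows "rec_in X (\<lambda>n. Suc (f n))"
proof -
  obtain p where "\<And>n. oeval X p [n] (f n)" using assms by (auto simp: rec_in_def)
  then have "oeval X (Comp S [p]) [n] (Suc (f n))" for n
    by (blast intro: oeval_comp1 oeval.succ)
  then show ?thesis unfolding rec_in_def by blast
qed

lemma rec_comp: assumes "rec_in X g" "rec_in X f" shows "rec_in X (\<lambda>n. g (f n))"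
proof -
  obtain p q where "\<And>n. oeval X p [n] (f n)" "\<And>n. oeval X q [n] (g n)"
    using assms by (auto simp: rec_in_def)
  then have "oeval X (Comp q [p]) [n] (g (f n))" for n
    by (blast intro: oeval_comp1)
  then show ?thesis unfolding rec_in_def by blast
qed

lemma rec_const: "rec_in X (\<lambda>n. c)"
proof (induction c)
  case 0
  show ?case unfolding rec_in_def by (blast intro: oeval.zero)
next
  case (Suc c)
  then show ?case by (rule rec_Suc)
qed

lemma rec_rec2:
  assumes "rec2_in X h" "rec_in X f" "rec_in X g"
  shows "rec_in X (\<lambda>n. h (f n) (g n))"
proof -
  obtain p q r where "\<And>n. oeval X p [n] (f n)" "\<And>n. oeval X q [n] (g n)"
    "\<And>a b. oeval X r [a, b] (h a b)"
    using assms by (auto simp: rec_in_def rec2_in_def)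
  then have "oeval X (Comp r [p, q]) [n] (h (f n) (g n))" for n
    by (blast intro: oeval_comp2)
  then show ?thesis unfolding rec_in_def by blast
qed

lemma rec2_rec2:
  assumes "rec2_in X h" "rec2_in X f" "rec2_in X g"
  shows "rec2_in X (\<lambda>a b. h (f a b) (g a b))"
proof -
  obtain p q r where "\<And>a b. oeval X p [a, b] (f a b)" "\<And>a b. oeval X q [a, b] (g a b)"
    "\<And>a b. oeval X r [a, b] (h a b)"
    using assms by (auto simp: rec2_in_def)
  then have "oeval X (Comp r [p, q]) [a, b] (h (f a b) (g a b))" for a b
    by (blast intro: oeval_comp2)
  then show ?thesis unfolding rec2_in_def by blast
qed

lemma rec3_rec2:
  assumes "rec2_in X h" "rec3_in X f" "rec3_in X g"
  shows "rec3_in X (\<lambda>a b c. h (f a b c) (g a b c))"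
proof -
  obtain p q r where "\<And>a b c. oeval X p [a, b, c] (f a b c)" "\<And>a b c. oeval X q [a, b, c] (g a b c)"
    "\<And>a b. oeval X r [a, b] (h a b)"
    using assms by (auto simp: rec3_in_def rec2_in_def)
  then have "oeval X (Comp r [p, q]) [a, b, c] (h (f a b c) (g a b c))" for a b c
    by (blast intro: oeval_comp2)
  then show ?thesis unfolding rec3_in_def by blast
qed

lemma rec2_rec: assumes "rec_in X g" "rec2_in X f" shows "rec2_in X (\<lambda>a b. g (f a b))"
proof -
  obtain p q where "\<And>a b. oeval X p [a, b] (f a b)" "\<And>n. oeval X q [n] (g n)"
    using assms by (auto simp: rec_in_def rec2_in_def)
  then have "oeval X (Comp q [p]) [a, b] (g (f a b))" for a b
    by (blast intro: oeval_comp1)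
  then show ?thesis unfolding rec2_in_def by blast
qed

lemma rec3_rec: assumes "rec_in X g" "rec3_in X f" shows "rec3_in X (\<lambda>a b c. g (f a b c))"
proof -
  obtain p q where "\<And>a b c. oeval X p [a, b, c] (f a b c)" "\<And>n. oeval X q [n] (g n)"
    using assms by (auto simp: rec_in_def rec3_in_def)
  then have "oeval X (Comp q [p]) [a, b, c] (g (f a b c))" for a b c
    by (blast intro: oeval_comp1)
  then show ?thesis unfolding rec3_in_def by blast
qed

lemma rec2_proj: "rec2_in X (\<lambda>a b. a)" "rec2_in X (\<lambda>a b. b)"
  unfolding rec2_in_def
  by (rule exI[of _ "Id 0"], auto intro: oeval_proj)
     (rule exI[of _ "Id 1"], auto intro: oeval_proj)

lemma rec3_proj: "rec3_in X (\<lambda>a b c. a)" "rec3_in X (\<lambda>a b c. b)" "rec3_in X (\<lambda>a b c. c)"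
  unfolding rec3_in_def
  by (rule exI[of _ "Id 0"], auto intro: oeval_proj)
     (rule exI[of _ "Id 1"], auto intro: oeval_proj,
      rule exI[of _ "Id 2"], auto intro: oeval_proj)

lemma rec2_primrec:
  assumes "rec_in X f" "rec3_in X g"
  shows "rec2_in X (\<lambda>n b. rec_nat (f b) (\<lambda>i r. g r i b) n)"
proof -
  obtain p q where p: "\<And>n. oeval X p [n] (f n)" and q: "\<And>a b c. oeval X q [a, b, c] (g a b c)"
    using assms by (auto simp: rec_in_def rec3_in_def)
  have "oeval X (Pr p q) [n, b] (rec_nat (f b) (\<lambda>i r. g r i b) n)" for n b
  proof (induction n)
    case 0
    show ?case using p by (auto intro: oeval.pr0)
  next
    case (Suc n)
    show ?case using oeval.prS[OF Suc q] by simp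
  qed
  then show ?thesis unfolding rec2_in_def by blast
qed

section \<open>Arithmetic, unbounded search and the inverse of pairing\<close>

lemma rec2_add: "rec2_in X (+)"
proof -
  have "rec_nat b (\<lambda>i. Suc) n = n + b" for n b :: nat by (induction n) auto
  then show ?thesis
    using rec2_primrec[OF rec_id rec3_rec[OF rec_Suc[OF rec_id] rec3_proj(1)]] by (simp add: fun_eq_iff)
qed

lemma rec2_mult: "rec2_in X (*)"
proof -
  have "rec_nat 0 (\<lambda>i r. r + b) n = n * b" for n b :: nat by (induction n) auto
  then show ?thesis
    using rec2_primrec[OF rec_const[of X 0] rec3_rec2[OF rec2_add rec3_proj(1) rec3_proj(3)]] by simp
qed

lemma rec_pred: assumes "rec_in X f" shows "rec_in X (\<lambda>n. f n - 1)"
proof -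
  have "rec_nat 0 (\<lambda>i r. i) n = n - 1" for n :: nat by (cases n) auto
  then have "rec2_in X (\<lambda>n b. n - 1)"
    using rec2_primrec[OF rec_const[of X 0] rec3_proj(2)] by simp
  from rec_rec2[OF this assms assms] show ?thesis .
qed

lemma rec2_diff: "rec2_in X (\<lambda>a b. a - b)"
proof -
  have "rec_nat b (\<lambda>i r. r - 1) n = b - n" for n b :: nat by (induction n) auto
  then have "rec2_in X (\<lambda>n b. b - n)"
    using rec2_primrec[OF rec_id rec3_rec[OF rec_pred[OF rec_id] rec3_proj(1)]] by simp
  from rec2_rec2[OF this rec2_proj(2) rec2_proj(1)] show ?thesis .
qed

lemmas rec_add = rec_rec2[OF rec2_add]
  and rec_mult = rec_rec2[OF rec2_mult]
  and rec_diff = rec_rec2[OF rec2_diff]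

lemma rec_triangle: assumes "rec_in X f" shows "rec_in X (\<lambda>n. triangle (f n))"
proof -
  have "rec_nat 0 (\<lambda>i r. r + Suc i) n = triangle n" for n :: nat by (induction n) auto
  then have "rec2_in X (\<lambda>n b. triangle n)"
    using rec2_primrec[OF rec_const[of X 0]
      rec3_rec2[OF rec2_add rec3_proj(1) rec3_rec[OF rec_Suc[OF rec_id] rec3_proj(2)]]] by simp
  from rec_rec2[OF this assms assms] show ?thesis .
qed

lemma rec2_pair: "rec2_in X pair"
proof -
  have eq: "pair = (\<lambda>a b. triangle (a + b) + a)" by (simp add: fun_eq_iff pair_def prod_encode_def)
  show ?thesis unfolding eq
    by (intro rec2_rec2[OF rec2_add] rec2_proj rec2_rec[OF rec_triangle[OF rec_id]])
qed

lemmas rec_pair = rec_rec2[OF rec2_pair]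

text \<open>The search by \<open>Mn\<close> halts because a zero exists, and every earlier value is
  defined because \<open>g\<close> is total.\<close>

lemma rec_Least2:
  assumes "rec2_in X g" "\<And>n. \<exists>i. g n i = 0"
  shows "rec_in X (\<lambda>n. LEAST i. g n i = 0)"
proof -
  have "rec2_in X (\<lambda>i n. g n i)" by (rule rec2_rec2[OF assms(1) rec2_proj(2) rec2_proj(1)])
  then obtain p where p: "\<And>i n. oeval X p [i, n] (g n i)" by (auto simp: rec2_in_def)
  have "oeval X (Mn p) [n] (LEAST i. g n i = 0)" for n
  proof (rule oeval.mn)
    have "g n (LEAST i. g n i = 0) = 0" using assms(2) by (metis (mono_tags, lifting) LeastI)
    then show "oeval X p [LEAST i. g n i = 0, n] 0" using p by metis
    show "\<forall>u<LEAST i. g n i = 0. \<exists>r. oeval X p [u, n] r \<and> r \<noteq> 0"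
      using p not_less_Least by blast
  qed
  then show ?thesis unfolding rec_in_def by blast
qed

lemma triangle_le: "a \<le> b \<Longrightarrow> triangle a \<le> triangle b"
  by (induction b) (auto simp: le_Suc_eq)

lemma le_triangle: "n \<le> triangle n"
  by (induction n) auto

text \<open>Since \<open>pair a b\<close> is \<open>triangle (a + b) + a\<close>, the diagonal
  \<open>a + b\<close> is the least \<open>i\<close> with \<open>n < triangle (Suc i)\<close>. This
  inequality is written as a vanishing truncated difference to fit unbounded search.\<close>

lemma p1_p2_eq_Least:
  defines "s \<equiv> \<lambda>n. LEAST i. Suc n - triangle (Suc i) = 0"
  shows "p1 n = n - triangle (s n)" "p2 n = s n - p1 n"
proof -
  define a b where "a = p1 n" and "b = p2 n"
  have n: "n = triangle (a + b) + a"
    using pair_p1_p2[of n] by (simp add: a_def b_def pair_def prod_encode_def)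
  have "s n = a + b" unfolding s_def
  proof (rule Least_equality)
    show "Suc n - triangle (Suc (a + b)) = 0" using n by simp
  next
    fix i assume i: "Suc n - triangle (Suc i) = 0"
    show "a + b \<le> i"
    proof (rule ccontr)
      assume "\<not> a + b \<le> i"
      then have "triangle (Suc i) \<le> triangle (a + b)" by (intro triangle_le) simp
      then show False using i n by simp
    qed
  qed
  moreover have "n - triangle (a + b) = a" using n by linarith
  ultimately show "p1 n = n - triangle (s n)" "p2 n = s n - p1 n"
    by (simp_all only: a_def[symmetric] b_def[symmetric] add_diff_cancel_left')
qed

lemma rec_root: "rec_in X (\<lambda>n. LEAST i. Suc n - triangle (Suc i) = 0)"
proof (rule rec_Least2)
  show "rec2_in X (\<lambda>n i. Suc n - triangle (Suc i))"
    by (intro rec2_rec2[OF rec2_diff] rec2_rec[OF rec_triangle[OF rec_Suc[OF rec_id]]]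
        rec2_rec[OF rec_Suc[OF rec_id]] rec2_proj)
  show "\<exists>i. Suc n - triangle (Suc i) = 0" for n
    using le_triangle[of "Suc n"] by (metis diff_is_0_eq)
qed

lemma rec_p1: assumes "rec_in X f" shows "rec_in X (\<lambda>n. p1 (f n))"
proof -
  have "rec_in X p1"
    unfolding p1_p2_eq_Least(1)[abs_def]
    by (intro rec_diff rec_id rec_triangle rec_root)
  from rec_comp[OF this assms] show ?thesis .
qed

lemma rec_p2: assumes "rec_in X f" shows "rec_in X (\<lambda>n. p2 (f n))"
proof -
  have "rec_in X p2"
    unfolding p1_p2_eq_Least(2)[abs_def]
    by (intro rec_diff rec_id rec_root rec_p1)
  from rec_comp[OF this assms] show ?thesis .
qed

lemma rec2_iff: "rec2_in X f \<longleftrightarrow> rec_in X (\<lambda>m. f (p1 m) (p2 m))"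
proof
  assume "rec2_in X f"
  from rec_rec2[OF this rec_p1[OF rec_id] rec_p2[OF rec_id]]
  show "rec_in X (\<lambda>m. f (p1 m) (p2 m))" .
next
  assume "rec_in X (\<lambda>m. f (p1 m) (p2 m))"
  from rec2_rec[OF this rec2_pair] show "rec2_in X f" by simp
qed

text \<open>The step is presented as a unary function of the coded triple
  \<open>pair (pair n i) r\<close>, so that the introduction rules for unary functions suffice to
  prove it computable.\<close>

lemma rec_primrec:
  assumes "rec_in X f" "rec_in X (\<lambda>m. g (p1 (p1 m)) (p2 (p1 m)) (p2 m))" "rec_in X h"
  shows "rec_in X (\<lambda>n. rec_nat (f n) (g n) (h n))"
proof -
  have "rec3_in X (\<lambda>r i n. pair (pair n i) r)"
    by (intro rec3_rec2[OF rec2_pair] rec3_proj)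
  from rec3_rec[OF assms(2) this] have "rec3_in X (\<lambda>r i n. g n i r)" by simp
  from rec2_primrec[OF assms(1) this]
  have "rec2_in X (\<lambda>k n. rec_nat (f n) (g n) k)" by simp
  from rec_rec2[OF this assms(3) rec_id] show ?thesis .
qed

subsection \<open>Decidable and semidecidable predicates\<close>

definition dec_in :: "(nat \<Rightarrow> bool) \<Rightarrow> (nat \<Rightarrow> bool) \<Rightarrow> bool" where
  "dec_in X P \<longleftrightarrow> rec_in X (\<lambda>n. of_bool (P n))"

lemma turing_le_iff_dec_in: "turing_le b X \<longleftrightarrow> dec_in X b"
  by (simp add: turing_le_def dec_in_def rec_in_def of_bool_def)

lemma dec_oracle: "dec_in X X"
  unfolding turing_le_iff_dec_in[symmetric] turing_le_def
  by (blast intro: oeval.orc)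

lemma dec_comp: "dec_in X P \<Longrightarrow> rec_in X f \<Longrightarrow> dec_in X (\<lambda>n. P (f n))"
  unfolding dec_in_def by (rule rec_comp)

lemma rec_of_bool: "dec_in X P \<Longrightarrow> rec_in X (\<lambda>n. of_bool (P n))"
  by (simp add: dec_in_def)

lemma dec_not: assumes "dec_in X P" shows "dec_in X (\<lambda>n. \<not> P n)"
proof -
  have "rec_in X (\<lambda>n. 1 - of_bool (P n))" by (intro rec_diff rec_const rec_of_bool assms)
  moreover have "(\<lambda>n. 1 - of_bool (P n)) = (\<lambda>n. of_bool (\<not> P n) :: nat)" by auto
  ultimately show ?thesis by (simp only: dec_in_def)
qed

lemma dec_conj: assumes "dec_in X P" "dec_in X Q" shows "dec_in X (\<lambda>n. P n \<and> Q n)"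
proof -
  have "rec_in X (\<lambda>n. of_bool (P n) * of_bool (Q n))" by (intro rec_mult rec_of_bool assms)
  then show ?thesis by (simp add: dec_in_def of_bool_conj)
qed

lemma dec_disj: assumes "dec_in X P" "dec_in X Q" shows "dec_in X (\<lambda>n. P n \<or> Q n)"
  using dec_not[OF dec_conj[OF dec_not[OF assms(1)] dec_not[OF assms(2)]]] by simp

lemma dec_le: assumes "rec_in X f" "rec_in X g" shows "dec_in X (\<lambda>n. f n \<le> g n)"
proof -
  have "rec_in X (\<lambda>n. 1 - (f n - g n))" by (intro rec_diff rec_const assms)
  moreover have "(\<lambda>n. 1 - (f n - g n)) = (\<lambda>n. of_bool (f n \<le> g n))" by (auto simp: fun_eq_iff)
  ultimately show ?thesis by (simp only: dec_in_def)
qed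

lemma dec_less: "rec_in X f \<Longrightarrow> rec_in X g \<Longrightarrow> dec_in X (\<lambda>n. f n < g n)"
  using dec_not[OF dec_le[of X g f]] by (simp only: not_le)

lemma dec_eq: "rec_in X f \<Longrightarrow> rec_in X g \<Longrightarrow> dec_in X (\<lambda>n. f n = g n)"
  using dec_conj[OF dec_le[of X f g] dec_le[of X g f]] by (simp only: order_eq_iff)

lemma rec_if:
  assumes "dec_in X P" "rec_in X f" "rec_in X g"
  shows "rec_in X (\<lambda>n. if P n then f n else g n)"
proof -
  have "rec_in X (\<lambda>n. of_bool (P n) * f n + of_bool (\<not> P n) * g n)"
    by (intro rec_add rec_mult rec_of_bool dec_not assms)
  moreover have "(\<lambda>n. of_bool (P n) * f n + of_bool (\<not> P n) * g n) = (\<lambda>n. if P n then f n else g n)"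
    by (auto simp: fun_eq_iff)
  ultimately show ?thesis by simp
qed

lemma dec_if:
  assumes "dec_in X P" "dec_in X Q" "dec_in X R"
  shows "dec_in X (\<lambda>n. if P n then Q n else R n)"
  unfolding if_bool_eq_disj by (intro dec_disj dec_conj dec_not assms)

text \<open>Bounded search is a primitive recursion whose accumulator becomes 1 at the first witness
  and stays 1.\<close>

lemma dec_bex:
  assumes "dec_in X (\<lambda>m. P (p1 m) (p2 m))" "rec_in X f"
  shows "dec_in X (\<lambda>n. \<exists>i<f n. P n i)"
proof -
  have eq: "rec_nat 0 (\<lambda>i r. if P n i then 1 else r) k = of_bool (\<exists>i<k. P n i)" for n k
    by (induction k) (auto simp: less_Suc_eq)
  have "dec_in X (\<lambda>m. P (p1 (p1 m)) (p2 (p1 m)))"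
    using dec_comp[OF assms(1) rec_p1[OF rec_id]] .
  then have "rec_in X (\<lambda>n. rec_nat 0 (\<lambda>i r. if P n i then 1 else r) (f n))"
    by (intro rec_primrec rec_const rec_if rec_p2 rec_id assms(2))
  then show ?thesis by (simp only: eq dec_in_def)
qed

lemma dec_ball:
  assumes "dec_in X (\<lambda>m. P (p1 m) (p2 m))" "rec_in X f"
  shows "dec_in X (\<lambda>n. \<forall>i<f n. P n i)"
proof -
  have "dec_in X (\<lambda>n. \<not> (\<exists>i<f n. \<not> P n i))" by (intro dec_not dec_bex assms)
  then show ?thesis by simp
qed

lemma rec_Least:
  assumes "dec_in X (\<lambda>m. P (p1 m) (p2 m))" "\<And>n. \<exists>i. P n i"
  shows "rec_in X (\<lambda>n. LEAST i. P n i)"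
proof -
  have "rec2_in X (\<lambda>n i. of_bool (\<not> P n i))"
    unfolding rec2_iff by (intro rec_of_bool dec_not assms(1))
  from rec_Least2[OF this] assms(2) show ?thesis by simp
qed

section \<open>Semidecidable predicates, in the form of projections of decidable ones\<close>

definition re_in :: "(nat \<Rightarrow> bool) \<Rightarrow> (nat \<Rightarrow> bool) \<Rightarrow> bool" where
  "re_in X P \<longleftrightarrow> (\<exists>R. dec_in X (\<lambda>m. R (p1 m) (p2 m)) \<and> (\<forall>n. P n \<longleftrightarrow> (\<exists>w. R n w)))"

lemma re_inI:
  "dec_in X (\<lambda>m. R (p1 m) (p2 m)) \<Longrightarrow> (\<And>n. P n \<longleftrightarrow> (\<exists>w. R n w)) \<Longrightarrow> re_in X P"
  unfolding re_in_def by (rule exI[of _ R]) (rule conjI, assumption, rule allI)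

lemma re_inE:
  assumes "re_in X P"
  obtains R where "dec_in X (\<lambda>m. R (p1 m) (p2 m))" "\<And>n. P n \<longleftrightarrow> (\<exists>w. R n w)"
proof -
  have "\<exists>R. dec_in X (\<lambda>m. R (p1 m) (p2 m)) \<and> (\<forall>n. P n \<longleftrightarrow> (\<exists>w. R n w))"
    using assms by (simp only: re_in_def)
  then show ?thesis
  proof (elim exE conjE)
    fix R assume "dec_in X (\<lambda>m. R (p1 m) (p2 m))" "\<forall>n. P n \<longleftrightarrow> (\<exists>w. R n w)"
    then show ?thesis by (intro that[of R]) (assumption, rule spec)
  qed
qed

lemma re_dec: assumes "dec_in X P" shows "re_in X P"
proof (rule re_inI[where R = "\<lambda>n w. P n"])
  show "dec_in X (\<lambda>m. P (p1 m))" by (rule dec_comp[OF assms rec_p1[OF rec_id]])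
qed simp

lemma re_ex:
  assumes "re_in X (\<lambda>m. P (p1 m) (p2 m))"
  shows "re_in X (\<lambda>n. \<exists>i. P n i)"
proof -
  obtain R where R: "dec_in X (\<lambda>m. R (p1 m) (p2 m))" "\<And>m. P (p1 m) (p2 m) \<longleftrightarrow> (\<exists>w. R m w)"
    using assms by (elim re_inE that)
  have "rec_in X (\<lambda>m. pair (pair (p1 m) (p1 (p2 m))) (p2 (p2 m)))"
    by (intro rec_pair rec_p1 rec_p2 rec_id)
  from dec_comp[OF R(1) this]
  have "dec_in X (\<lambda>m. R (pair (p1 m) (p1 (p2 m))) (p2 (p2 m)))" by simp
  moreover have "(\<exists>i. P n i) \<longleftrightarrow> (\<exists>w. R (pair n (p1 w)) (p2 w))" for n
  proof -
    have "P n i \<longleftrightarrow> (\<exists>w. R (pair n i) w)" for i using R(2)[of "pair n i"] by simp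
    then show ?thesis by (metis p1_pair p2_pair)
  qed
  ultimately show ?thesis by (rule re_inI[where R = "\<lambda>n w. R (pair n (p1 w)) (p2 w)"])
qed

lemma re_comp:
  assumes "re_in X P" "rec_in X f"
  shows "re_in X (\<lambda>n. P (f n))"
proof -
  obtain R where R: "dec_in X (\<lambda>m. R (p1 m) (p2 m))" "\<And>m. P m \<longleftrightarrow> (\<exists>w. R m w)"
    using assms by (elim re_inE that)
  have "rec_in X (\<lambda>m. pair (f (p1 m)) (p2 m))"
    by (intro rec_pair rec_comp[OF assms(2)] rec_p1 rec_p2 rec_id)
  from dec_comp[OF R(1) this]
  have "dec_in X (\<lambda>m. R (f (p1 m)) (p2 m))" by simp
  then show ?thesis using R(2) by (rule re_inI[where R = "\<lambda>n. R (f n)"])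
qed

lemma re_conj:
  assumes "re_in X P" "re_in X Q"
  shows "re_in X (\<lambda>n. P n \<and> Q n)"
proof -
  obtain R where R: "dec_in X (\<lambda>m. R (p1 m) (p2 m))" "\<And>m. P m \<longleftrightarrow> (\<exists>w. R m w)"
    using assms(1) by (elim re_inE that)
  obtain T where T: "dec_in X (\<lambda>m. T (p1 m) (p2 m))" "\<And>m. Q m \<longleftrightarrow> (\<exists>w. T m w)"
    using assms(2) by (elim re_inE that)
  have "rec_in X (\<lambda>m. pair (p1 m) (p1 (p2 m)))" "rec_in X (\<lambda>m. pair (p1 m) (p2 (p2 m)))"
    by (intro rec_pair rec_p1 rec_p2 rec_id)+
  from dec_conj[OF dec_comp[OF R(1) this(1)] dec_comp[OF T(1) this(2)]]
  have "dec_in X (\<lambda>m. R (p1 m) (p1 (p2 m)) \<and> T (p1 m) (p2 (p2 m)))" by simp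
  moreover have "(P n \<and> Q n) \<longleftrightarrow> (\<exists>w. R n (p1 w) \<and> T n (p2 w))" for n
    using R(2) T(2) by (metis p1_pair p2_pair)
  ultimately show ?thesis by (rule re_inI[where R = "\<lambda>n w. R n (p1 w) \<and> T n (p2 w)"])
qed

text \<open>Finitely many witnesses have a common strict bound \<open>W\<close>, so the bounded
  quantifier moves inside the unbounded one and leaves a decidable matrix.\<close>

lemma re_ball:
  assumes "re_in X (\<lambda>m. P (p1 m) (p2 m))" "rec_in X f"
  shows "re_in X (\<lambda>n. \<forall>i<f n. P n i)"
proof -
  obtain R where R: "dec_in X (\<lambda>m. R (p1 m) (p2 m))" "\<And>m. P (p1 m) (p2 m) \<longleftrightarrow> (\<exists>w. R m w)"
    using assms(1) by (elim re_inE that)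
  have "rec_in X (\<lambda>k. pair (pair (p1 (p1 (p1 k))) (p2 (p1 k))) (p2 k))"
    by (intro rec_pair rec_p1 rec_p2 rec_id)
  from dec_comp[OF R(1) this]
  have "dec_in X (\<lambda>m. R (pair (p1 (p1 (p1 m))) (p2 (p1 m))) (p2 m))" by simp
  then have "dec_in X (\<lambda>m. \<forall>i<f (p1 m). \<exists>w<p2 m. R (pair (p1 m) i) w)"
    by (intro dec_ball dec_bex rec_p1 rec_p2 rec_id rec_comp[OF assms(2)])
  moreover have "(\<forall>i<f n. P n i) \<longleftrightarrow> (\<exists>W. \<forall>i<f n. \<exists>w<W. R (pair n i) w)" for n
  proof
    assume "\<forall>i<f n. P n i"
    then have "\<forall>i<f n. \<exists>w. R (pair n i) w" using R(2)[of "pair n i" for i] by auto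
    then obtain g where g: "\<And>i. i < f n \<Longrightarrow> R (pair n i) (g i)" by metis
    have "g i < Suc (\<Sum>j<f n. g j)" if "i < f n" for i
      using member_le_sum[of i "{..<f n}" g] that by (simp add: le_imp_less_Suc)
    then show "\<exists>W. \<forall>i<f n. \<exists>w<W. R (pair n i) w" using g by blast
  next
    assume "\<exists>W. \<forall>i<f n. \<exists>w<W. R (pair n i) w"
    then show "\<forall>i<f n. P n i" using R(2)[of "pair n i" for i] by auto
  qed
  ultimately show ?thesis
    by (rule re_inI[where R = "\<lambda>n W. \<forall>i<f n. \<exists>w<W. R (pair n i) w"])
qed

text \<open>Search for the least code of a value together with a witness that it lies in the graph.
  Totality of \<open>f\<close> makes the search halt, and whatever it finds is correct.\<close>

lemma rec_graph:
  assumes "re_in X (\<lambda>m. f (p1 m) = p2 m)"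
  shows "rec_in X f"
proof -
  obtain R where R: "dec_in X (\<lambda>m. R (p1 m) (p2 m))" "\<And>m. f (p1 m) = p2 m \<longleftrightarrow> (\<exists>w. R m w)"
    using assms by (elim re_inE that)
  define g where "g n = (LEAST w. R (pair n (p1 w)) (p2 w))" for n
  have "rec_in X (\<lambda>m. pair (pair (p1 m) (p1 (p2 m))) (p2 (p2 m)))"
    by (intro rec_pair rec_p1 rec_p2 rec_id)
  from dec_comp[OF R(1) this]
  have D: "dec_in X (\<lambda>m. R (pair (p1 m) (p1 (p2 m))) (p2 (p2 m)))" by simp
  have E: "\<exists>w. R (pair n (p1 w)) (p2 w)" for n
    using R(2)[of "pair n (f n)"] by (metis p1_pair p2_pair)
  have "rec_in X g" unfolding g_def by (rule rec_Least) (fact D E)+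
  then have "rec_in X (\<lambda>n. p1 (g n))" by (rule rec_p1)
  moreover have "R (pair n (p1 (g n))) (p2 (g n))" for n
    unfolding g_def using LeastI_ex[OF E] .
  then have "p1 (g n) = f n" for n using R(2)[of "pair n (p1 (g n))"] by auto
  ultimately show ?thesis by simp
qed

lemma rec_mod3: assumes "rec_in X f" shows "rec_in X (\<lambda>n. f n mod 3)"
proof (rule rec_graph)
  have "(k mod 3 = r) \<longleftrightarrow> (\<exists>q. k = 3 * q + r \<and> r < 3)" for k r :: nat
    by presburger
  moreover have "re_in X (\<lambda>m. \<exists>q. f (p1 m) = 3 * q + p2 m \<and> p2 m < 3)"
    by (intro re_ex re_dec dec_conj dec_eq dec_less rec_add rec_mult rec_const rec_comp[OF assms]
        rec_p1 rec_p2 rec_id)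
  ultimately show "re_in X (\<lambda>m. f (p1 m) mod 3 = p2 m)" by (simp only:)
qed

subsection \<open>A universal machine\<close>

definition cons :: "nat \<Rightarrow> nat \<Rightarrow> nat" where
  "cons a l = Suc (pair a l)"

definition hd_code :: "nat \<Rightarrow> nat" where
  "hd_code l = p1 (l - 1)"

definition tl_code :: "nat \<Rightarrow> nat" where
  "tl_code l = p2 (l - 1)"

lemma cons_simps [simp]: "hd_code (cons a l) = a" "tl_code (cons a l) = l" "cons a l \<noteq> 0"
  by (simp_all add: cons_def hd_code_def tl_code_def)

text \<open>The successor in \<open>cons\<close> keeps 0 free for the empty list, which also serves
  as the empty stack.\<close>

lemma list_encode_Cons [simp]: "list_encode (a # l) = cons a (list_encode l)"
  by (simp add: cons_def pair_def list_encode.simps(2))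

declare list_encode.simps(2) [simp del]

fun code :: "recf \<Rightarrow> nat" where
  "code Z = pair 0 0"
| "code S = pair 1 0"
| "code (Id i) = pair 2 i"
| "code (Comp f gs) = pair 3 (pair (code f) (list_encode (map code gs)))"
| "code (Pr f g) = pair 4 (pair (code f) (code g))"
| "code (Mn f) = pair 5 (code f)"
| "code Orc = pair 6 0"

text \<open>A configuration carries a tag, two arguments and a stack of frames. Tag 0 evaluates the
  program \<open>a\<close> on the argument list \<open>b\<close>, tag 1 evaluates a list of programs, tag 2 performs the
  unbounded search of \<open>Mn\<close>, and tag 3 returns the value \<open>a\<close> to the topmost frame.\<close>

definition conf :: "nat \<Rightarrow> nat \<Rightarrow> nat \<Rightarrow> nat \<Rightarrow> nat" where
  "conf t a b K = pair t (pair a (pair b K))"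

abbreviation ret :: "nat \<Rightarrow> nat \<Rightarrow> nat" where
  "ret v K \<equiv> conf 3 v 0 K"

text \<open>The tag \<open>t\<close> is the constructor of the program and \<open>c\<close> codes
  its components. A projection walks down the list while lowering its index; \<open>Comp\<close>
  first evaluates its argument list, and \<open>Pr\<close> at a successor first evaluates the
  recursive call, each leaving a frame that says how to continue.\<close>

definition step_eval :: "(nat \<Rightarrow> bool) \<Rightarrow> nat \<Rightarrow> nat \<Rightarrow> nat \<Rightarrow> nat \<Rightarrow> nat" where
  "step_eval X t c xs K =
    (if t = 0 then ret 0 K
     else if t = 1 then ret (Suc (hd_code xs)) K
     else if t = 2 then
       (if c = 0 then ret (hd_code xs) K else conf 0 (pair 2 (c - 1)) (tl_code xs) K)
     else if t = 3 then conf 1 (p2 c) xs (cons (pair 0 (p1 c)) K)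
     else if t = 4 then
       (if hd_code xs = 0 then conf 0 (p1 c) (tl_code xs) K
        else conf 0 (pair 4 c) (cons (hd_code xs - 1) (tl_code xs))
          (cons (pair 3 (pair (p2 c) (cons (hd_code xs - 1) (tl_code xs)))) K))
     else if t = 5 then conf 2 (pair c 0) xs K
     else ret (of_bool (X (hd_code xs))) K)"

text \<open>Frame 0 holds the outer function of a \<open>Comp\<close> awaiting its arguments; frame
  1 the remaining programs of a list, frame 2 the value of its head; frame 3 the step function of a
  \<open>Pr\<close> awaiting the recursive value; frame 4 the current candidate of an unbounded
  search.\<close>

definition step_ret :: "nat \<Rightarrow> nat \<Rightarrow> nat \<Rightarrow> nat \<Rightarrow> nat" where
  "step_ret v t c K =
    (if t = 0 then conf 0 c v K
     else if t = 1 then conf 1 (p1 c) (p2 c) (cons (pair 2 v) K)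
     else if t = 2 then ret (cons c v) K
     else if t = 3 then conf 0 (p1 c) (cons v (p2 c)) K
     else if v = 0 then ret (p2 (p1 c)) K
     else conf 2 (pair (p1 (p1 c)) (Suc (p2 (p1 c)))) (p2 c) K)"

text \<open>Returning to the empty stack is a fixed point, so a halted run keeps its result
  forever.\<close>

definition step_conf :: "(nat \<Rightarrow> bool) \<Rightarrow> nat \<Rightarrow> nat \<Rightarrow> nat \<Rightarrow> nat \<Rightarrow> nat" where
  "step_conf X t a b K =
    (if t = 0 then step_eval X (p1 a) (p2 a) b K
     else if t = 1 then
       (if a = 0 then ret 0 K
        else conf 0 (hd_code a) b (cons (pair 1 (pair (tl_code a) b)) K))
     else if t = 2 then conf 0 (p1 a) (cons (p2 a) b) (cons (pair 4 (pair a b)) K)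
     else if K = 0 then conf t a b K
     else step_ret a (p1 (hd_code K)) (p2 (hd_code K)) (tl_code K))"

definition step :: "(nat \<Rightarrow> bool) \<Rightarrow> nat \<Rightarrow> nat" where
  "step X s = step_conf X (p1 s) (p1 (p2 s)) (p1 (p2 (p2 s))) (p2 (p2 (p2 s)))"

lemma step_conf_eq [simp]: "step X (conf t a b K) = step_conf X t a b K"
  by (simp add: step_def conf_def)

section \<open>Runs of the machine and their correctness for \<open>oeval\<close>\<close>

definition reaches :: "(nat \<Rightarrow> bool) \<Rightarrow> nat \<Rightarrow> nat \<Rightarrow> bool" where
  "reaches X s s' \<longleftrightarrow> (\<exists>k. (step X ^^ k) s = s')"

lemma reaches_refl: "reaches X s s"
  unfolding reaches_def by (rule exI[of _ 0]) simp

lemma reaches_trans: "reaches X s s' \<Longrightarrow> reaches X s' s'' \<Longrightarrow> reaches X s s''"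
  unfolding reaches_def by (metis funpow_add o_apply)

lemma reaches_step: "reaches X (step X s) s' \<Longrightarrow> reaches X s s'"
  unfolding reaches_def by (metis funpow_Suc_right o_apply)

text \<open>The premise holds for every stack because each member of the list is evaluated beneath
  additional frames.\<close>

lemma reaches_evals:
  assumes "list_all2 (\<lambda>g y. \<forall>K. reaches X (conf 0 (code g) xs K) (ret y K)) gs ys"
  shows "reaches X (conf 1 (list_encode (map code gs)) xs K) (ret (list_encode ys) K)"
  using assms
proof (induction gs ys arbitrary: K rule: list_all2_induct)
  case Nil
  show ?case by (rule reaches_step) (simp add: step_conf_def reaches_refl)
next
  case (Cons g gs y ys)
  let ?F = "\<lambda>K. cons (pair 1 (pair (list_encode (map code gs)) xs)) K"
  have "reaches X (ret (list_encode ys) (cons (pair 2 y) K)) (ret (list_encode (y # ys)) K)"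
    by (rule reaches_step) (simp add: step_conf_def step_ret_def reaches_refl)
  from reaches_trans[OF Cons.IH this]
  have "reaches X (ret y (?F K)) (ret (list_encode (y # ys)) K)"
    by (intro reaches_step[of _ "ret y (?F K)"]) (simp add: step_conf_def step_ret_def)
  from reaches_trans[OF _ this] Cons.hyps
  show ?case
    by (intro reaches_step[of _ "conf 1 _ _ _"]) (simp add: step_conf_def)
qed

text \<open>Induction runs downwards from \<open>v\<close>: a nonzero result at a candidate
  \<open>u\<close> passes the search on to \<open>Suc u\<close>.\<close>

lemma reaches_search:
  assumes "\<And>K. reaches X (conf 0 f (cons v xs) K) (ret 0 K)"
    and "\<And>u. u < v \<Longrightarrow> \<exists>r. r \<noteq> 0 \<and> (\<forall>K. reaches X (conf 0 f (cons u xs) K) (ret r K))"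
    and "u \<le> v"
  shows "reaches X (conf 2 (pair f u) xs K) (ret v K)"
  using assms(3)
proof (induction rule: inc_induct)
  case base
  have "reaches X (ret 0 (cons (pair 4 (pair (pair f v) xs)) K)) (ret v K)"
    by (rule reaches_step) (simp add: step_conf_def step_ret_def reaches_refl)
  from reaches_trans[OF assms(1) this] show ?case
    by (intro reaches_step[of _ "conf 2 _ _ _"]) (simp add: step_conf_def)
next
  case (step u)
  then obtain r where r: "r \<noteq> 0" "\<And>K. reaches X (conf 0 f (cons u xs) K) (ret r K)"
    using assms(2) by blast
  have "reaches X (ret r (cons (pair 4 (pair (pair f u) xs)) K)) (ret v K)"
    using step.IH r(1) by (intro reaches_step[of _ "ret r _"]) (simp add: step_conf_def step_ret_def)
  from reaches_trans[OF r(2) this] show ?case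
    by (intro reaches_step[of _ "conf 2 _ _ _"]) (simp add: step_conf_def)
qed

lemma reaches_proj:
  "i < length xs \<Longrightarrow> reaches X (conf 0 (pair 2 i) (list_encode xs) K) (ret (xs ! i) K)"
proof (induction i arbitrary: xs)
  case 0
  then obtain y ys where "xs = y # ys" by (cases xs) auto
  then show ?case
    by (intro reaches_step[of _ "conf 0 _ _ _"]) (simp add: step_conf_def step_eval_def reaches_refl)
next
  case (Suc i)
  then obtain y ys where "xs = y # ys" by (cases xs) auto
  with Suc show ?case
    by (intro reaches_step[of _ "conf 0 _ _ _"]) (simp add: step_conf_def step_eval_def)
qed

text \<open>Rule induction with an arbitrary stack, so that the hypotheses apply beneath pushed
  frames. As runs are deterministic, a program that computes a real can then return no wrong
  value.\<close>

lemma oeval_imp_reaches: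
  "oeval X p xs v \<Longrightarrow> reaches X (conf 0 (code p) (list_encode xs) K) (ret v K)"
proof (induction arbitrary: K rule: oeval.induct)
  case (zero xs)
  show ?case by (rule reaches_step) (simp add: step_conf_def step_eval_def reaches_refl)
next
  case (succ x xs)
  show ?case by (rule reaches_step) (simp add: step_conf_def step_eval_def reaches_refl)
next
  case (proj i xs)
  then show ?case by (simp add: reaches_proj)
next
  case (comp xs gs ys f v)
  have "list_all2 (\<lambda>g y. \<forall>K. reaches X (conf 0 (code g) (list_encode xs) K) (ret y K)) gs ys"
    using comp(1) by (rule list_all2_mono) blast
  note evals = reaches_evals[OF this]
  have "reaches X (ret (list_encode ys) (cons (pair 0 (code f)) K)) (ret v K)"
    using comp.IH by (intro reaches_step[of _ "ret _ _"]) (simp add: step_conf_def step_ret_def)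
  from reaches_trans[OF evals this] show ?case
    by (intro reaches_step[of _ "conf 0 _ _ _"]) (simp add: step_conf_def step_eval_def)
next
  case (pr0 f xs v g)
  then show ?case
    by (intro reaches_step[of _ "conf 0 _ _ _"]) (simp add: step_conf_def step_eval_def)
next
  case (prS f g n xs r v)
  have "reaches X (ret r (cons (pair 3 (pair (code g) (cons n (list_encode xs)))) K)) (ret v K)"
    using prS.IH(2) by (intro reaches_step[of _ "ret _ _"]) (simp add: step_conf_def step_ret_def)
  from reaches_trans[OF prS.IH(1) this] show ?case
    by (intro reaches_step[of _ "conf 0 _ _ _"]) (simp add: step_conf_def step_eval_def)
next
  case (mn f v xs)
  have "reaches X (conf 2 (pair (code f) 0) (list_encode xs) K) (ret v K)"
  proof (rule reaches_search)
    show "reaches X (conf 0 (code f) (cons v (list_encode xs)) K) (ret 0 K)" for K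
      using mn.IH(1) by simp
    show "\<exists>r. r \<noteq> 0 \<and> (\<forall>K. reaches X (conf 0 (code f) (cons u (list_encode xs)) K) (ret r K))"
      if "u < v" for u
      using mn.IH(2) that by auto
  qed simp
  then show ?case
    by (intro reaches_step[of _ "conf 0 _ _ _"]) (simp add: step_conf_def step_eval_def)
next
  case (orc n xs)
  show ?case by (rule reaches_step) (simp add: step_conf_def step_eval_def reaches_refl)
qed

text \<open>Here \<open>e\<close> is any number, whether or not it codes a program; if its run never
  halts, the predicate fails for both values of \<open>v\<close>.\<close>

definition univ_eval :: "(nat \<Rightarrow> bool) \<Rightarrow> nat \<Rightarrow> nat \<Rightarrow> bool \<Rightarrow> bool" where
  "univ_eval X e i v \<longleftrightarrow> reaches X (conf 0 e (cons i 0) 0) (ret (of_bool v) 0)"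

lemma ex_univ_eval:
  assumes "turing_le b X"
  shows "\<exists>e. \<forall>i. univ_eval X e i (b i)"
proof -
  obtain p where p: "\<And>n. oeval X p [n] (of_bool (b n))"
    using assms by (auto simp: turing_le_def of_bool_def)
  have "univ_eval X (code p) i (b i)" for i
    using oeval_imp_reaches[OF p, where K = 0] by (simp add: univ_eval_def)
  then show ?thesis by blast
qed

text \<open>Both runs are prolonged to the same length, which does not alter halted
  configurations.\<close>

lemma univ_eval_unique:
  assumes "univ_eval X e i v" "univ_eval X e i w"
  shows "v = w"
proof -
  have halt: "(step X ^^ k) (ret u 0) = ret u 0" for k u
    by (induction k) (simp_all add: step_conf_def)
  have *: "(step X ^^ k) s = ret u 0 \<Longrightarrow> k \<le> l \<Longrightarrow> (step X ^^ l) s = ret u 0" for k l s u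
    using halt by (metis le_add_diff_inverse2 funpow_add o_apply)
  from assms obtain k l where
    k: "(step X ^^ k) (conf 0 e (cons i 0) 0) = ret (of_bool v) 0" and
    l: "(step X ^^ l) (conf 0 e (cons i 0) 0) = ret (of_bool w) 0"
    by (auto simp: univ_eval_def reaches_def)
  have "ret (of_bool v) 0 = ret (of_bool w) 0"
    using *[OF k, of "max k l"] *[OF l, of "max k l"] by simp
  then have "p1 (p2 (ret (of_bool v) 0)) = p1 (p2 (ret (of_bool w) 0))" by simp
  then show ?thesis by (simp add: conf_def of_bool_eq_iff)
qed

text \<open>The machine with oracle \<open>X\<close> runs inside \<open>Y\<close>: its oracle
  questions are answered by a decision procedure for \<open>X\<close> relative to
  \<open>Y\<close>.\<close>

lemma rec_step:
  assumes "dec_in Y X" "rec_in Y f"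
  shows "rec_in Y (\<lambda>n. step X (f n))"
  unfolding step_def step_conf_def step_eval_def step_ret_def conf_def cons_def hd_code_def tl_code_def
  by (intro rec_if rec_pair rec_p1 rec_p2 rec_Suc rec_pred rec_of_bool dec_comp[OF assms(1)] dec_eq
      assms(2) rec_const)

text \<open>The witness is the number of steps, and iterating \<open>step\<close> is a primitive
  recursion.\<close>

lemma re_univ_eval:
  assumes "dec_in Y X" "rec_in Y e" "rec_in Y i" "dec_in Y v"
  shows "re_in Y (\<lambda>n. univ_eval X (e n) (i n) (v n))"
proof -
  have "(step X ^^ k) s = rec_nat s (\<lambda>_. step X) k" for k s by (induction k) auto
  then show ?thesis
    unfolding univ_eval_def reaches_def conf_def cons_def
    by (simp only:) (intro re_ex re_dec dec_eq rec_primrec rec_step[OF assms(1)] rec_pair rec_Suc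
        rec_const rec_comp[OF assms(2)] rec_comp[OF assms(3)] rec_of_bool dec_comp[OF assms(4)]
        rec_p1 rec_p2 rec_id)
qed

text \<open>Transitivity of Turing reducibility, obtained by simulating the universal machine
  instead of substituting programs for oracle calls.\<close>

lemma dec_in_trans:
  assumes "turing_le b X" "dec_in Y X"
  shows "dec_in Y b"
proof -
  obtain e where e: "\<And>i. univ_eval X e i (b i)" using ex_univ_eval[OF assms(1)] by blast
  \<comment> \<open>The guard \<open>m \<le> 1\<close> is needed because the test
    \<open>m = 1\<close> identifies all other numbers with falsity.\<close>
  have "of_bool (b n) = m \<longleftrightarrow> m \<le> 1 \<and> univ_eval X e n (m = 1)" for n and m :: nat
  proof -
    have "univ_eval X e n v \<longleftrightarrow> v = b n" for v using e univ_eval_unique by blast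
    from this[of "m = 1"] show ?thesis by (cases "b n") (simp_all, linarith+)
  qed
  moreover have "re_in Y (\<lambda>m. p2 m \<le> 1 \<and> univ_eval X e (p1 m) (p2 m = 1))"
    by (intro re_conj re_dec dec_le re_univ_eval assms(2) dec_eq rec_p1 rec_p2 rec_id rec_const)
  ultimately show ?thesis
    unfolding dec_in_def by (intro rec_graph) simp
qed

subsection \<open>Decoding\<close>

text \<open>Every number codes an infinite sequence, so no length has to be stored; any finite
  initial segment can be prescribed.\<close>

definition entry :: "nat \<Rightarrow> nat \<Rightarrow> nat" where
  "entry h i = p1 ((p2 ^^ i) h)"

lemma ex_entry: "\<exists>h. \<forall>i<n. entry h i = f i"
proof (induction n arbitrary: f)
  case 0
  show ?case by simp
next
  case (Suc n)
  obtain h where h: "\<And>i. i < n \<Longrightarrow> entry h i = f (Suc i)" using Suc[of "\<lambda>i. f (Suc i)"] by blast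
  have "entry (pair (f 0) h) i = f i" if "i < Suc n" for i
    using that h by (cases i) (simp_all add: entry_def funpow_Suc_right del: funpow.simps(2))
  then show ?case by blast
qed

lemma rec_entry:
  assumes "rec_in X f" "rec_in X g"
  shows "rec_in X (\<lambda>n. entry (f n) (g n))"
proof -
  have "(p2 ^^ k) s = rec_nat s (\<lambda>_. p2) k" for k s by (induction k) auto
  then show ?thesis
    unfolding entry_def
    by (simp only:) (intro rec_p1 rec_primrec assms rec_p2 rec_id)
qed

text \<open>A history starts with the fixed constants \<open>d 0\<close> and \<open>d 1\<close> and
  satisfies \<open>G\<close> at each step. Induction carrying two consecutive entries shows it is
  correct, so \<open>G\<close> has to be understood only at true values of \<open>d\<close>.\<close>

lemma rec_two_step:
  assumes re: "re_in X (\<lambda>m. G (p1 m) (entry (p2 m) (p1 m)) (entry (p2 m) (Suc (p1 m)))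
      (entry (p2 m) (p1 m + 2)))"
    and G: "\<And>t z. G t (d t) (d (Suc t)) z \<longleftrightarrow> z = d (t + 2)"
  shows "rec_in X d"
proof (rule rec_graph)
  define Hist where "Hist t h \<longleftrightarrow> entry h 0 = d 0 \<and> entry h 1 = d 1 \<and>
    (\<forall>s<t. G s (entry h s) (entry h (Suc s)) (entry h (s + 2)))" for t h
  have hist: "entry h s = d s \<and> entry h (Suc s) = d (Suc s)" if "Hist t h" "s \<le> t" for t h s
    using that(2)
  proof (induction s)
    case 0
    then show ?case using that(1) by (simp add: Hist_def)
  next
    case (Suc s)
    then have "s < t" by simp
    then have "G s (entry h s) (entry h (Suc s)) (entry h (s + 2))"
      using that(1) unfolding Hist_def by blast
    then show ?case using Suc.IH \<open>s < t\<close> G by simp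
  qed
  have "(d t = v) \<longleftrightarrow> (\<exists>h. Hist t h \<and> entry h t = v)" for t v
  proof
    assume "d t = v"
    obtain h where h: "\<And>i. i < t + 2 \<Longrightarrow> entry h i = d i" using ex_entry by blast
    have "Hist t h" unfolding Hist_def using h G by simp
    then show "\<exists>h. Hist t h \<and> entry h t = v" using h \<open>d t = v\<close> by auto
  next
    assume "\<exists>h. Hist t h \<and> entry h t = v"
    then show "d t = v" using hist by auto
  qed
  moreover have "re_in X (\<lambda>m. \<exists>h. Hist (p1 m) h \<and> entry h (p1 m) = p2 m)"
  proof -
    have G': "re_in X (\<lambda>k. G (p2 k) (entry (p2 (p1 k)) (p2 k)) (entry (p2 (p1 k)) (Suc (p2 k)))
      (entry (p2 (p1 k)) (p2 k + 2)))"
    proof -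
      have "rec_in X (\<lambda>k. pair (p2 k) (p2 (p1 k)))" by (intro rec_pair rec_p1 rec_p2 rec_id)
      from re_comp[OF re this] show ?thesis by simp
    qed
    show ?thesis
      unfolding Hist_def
      by (intro re_ex re_conj re_ball G' re_dec[OF dec_eq] rec_entry rec_p1 rec_p2 rec_id rec_const)
  qed
  ultimately show "re_in X (\<lambda>m. d (p1 m) = p2 m)" by simp
qed

text \<open>The real \<open>c (t mod 3)\<close> leaves its target \<open>p t\<close> exactly at \<open>d t\<close>. The two last clauses let
  a decoder knowing \<open>d t\<close> and \<open>d (Suc t)\<close> find a program for \<open>p (t + 2)\<close>: search among the indices
  up to \<open>d t\<close> for one that agrees with \<open>c ((t + 2) mod 3)\<close> below \<open>d (Suc t)\<close>.\<close>

definition tracks :: "(nat \<Rightarrow> bool) \<Rightarrow> (nat \<Rightarrow> nat \<Rightarrow> bool) \<Rightarrow> (nat \<Rightarrow> nat \<Rightarrow> bool) \<Rightarrow> (nat \<Rightarrow> nat) \<Rightarrow> bool"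
  where
  "tracks X c p d \<longleftrightarrow> (\<forall>t.
     agree_upto (d t) (p t) (c (t mod 3)) \<and> c (t mod 3) (d t) \<noteq> p t (d t) \<and> d t < d (Suc t) \<and>
     (\<exists>e\<le>d t. \<forall>i. univ_eval X e i (p (t + 2) i)) \<and>
     (\<forall>e\<le>d t. (\<forall>i<d (Suc t). univ_eval X e i (p (t + 2) i)) \<longrightarrow> (\<forall>i. univ_eval X e i (p (t + 2) i))))"

text \<open>Below \<open>d (Suc t)\<close> the real \<open>c ((t + 2) mod 3)\<close> still equals
  its target \<open>p (t + 2)\<close>, so an index up to \<open>d t\<close> that agrees with it
  there computes the whole target. The first place where this index and the real differ is then
  \<open>d (t + 2)\<close>.\<close>

lemma rec_tracks:
  assumes tr: "tracks X c p d" and X: "dec_in Y X" and c: "\<And>r. r < 3 \<Longrightarrow> dec_in Y (c r)"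
  shows "rec_in Y d"
proof -
  let ?c = "\<lambda>t. c ((t + 2) mod 3)"
  \<comment> \<open>Disagreement at \<open>z\<close> is stated as convergence to the opposite value,
    which keeps the condition semidecidable.\<close>
  let ?G = "\<lambda>t a b z. \<exists>e. e < Suc a \<and> (\<forall>i<b. univ_eval X e i (?c t i)) \<and> (\<forall>i<z. univ_eval X e i (?c t i)) \<and>
    univ_eval X e z (\<not> ?c t z)"
  have G: "?G t (d t) (d (Suc t)) z \<longleftrightarrow> z = d (t + 2)" for t z
  proof -
    let ?p = "p (t + 2)"
    have agree: "?c t i = ?p i" if "i < d (t + 2)" for i
      using tr that unfolding tracks_def agree_upto_def by metis
    have differ: "?c t (d (t + 2)) \<noteq> ?p (d (t + 2))"
      using tr unfolding tracks_def by metis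
    have less: "d (Suc t) < d (t + 2)"
      using tr unfolding tracks_def by (metis add_2_eq_Suc')
    have settled: "\<forall>i. univ_eval X e i (?p i)"
      if "e \<le> d t" "\<forall>i<d (Suc t). univ_eval X e i (?p i)" for e
      using tr that unfolding tracks_def by blast
    show ?thesis
    proof
      assume "?G t (d t) (d (Suc t)) z"
      then obtain e where e: "e \<le> d t" "\<forall>i<d (Suc t). univ_eval X e i (?c t i)"
        "\<forall>i<z. univ_eval X e i (?c t i)" "univ_eval X e z (\<not> ?c t z)"
        by (auto simp: less_Suc_eq_le)
      have u: "\<forall>i. univ_eval X e i (?p i)"
        using settled[OF e(1)] e(2) agree less by fastforce
      have "?c t i = ?p i" if "i < z" for i using univ_eval_unique u e(3) that by blast
      moreover have "?c t z \<noteq> ?p z" using univ_eval_unique u e(4) by blast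
      ultimately show "z = d (t + 2)" using agree differ by (metis linorder_neqE_nat)
    next
      assume z: "z = d (t + 2)"
      obtain e where e: "e \<le> d t" "\<And>i. univ_eval X e i (?p i)"
        using tr unfolding tracks_def by blast
      have "univ_eval X e i (?c t i)" if "i < d (t + 2)" for i using e(2)[of i] agree[OF that] by simp
      moreover have "univ_eval X e z (\<not> ?c t z)"
        using e(2)[of z] differ unfolding z by (cases "?p (d (t + 2))") auto
      ultimately show "?G t (d t) (d (Suc t)) z"
        using e(1) less unfolding z by (intro exI[of _ e]) auto
    qed
  qed
  \<comment> \<open>The three reals have separate decision procedures; a case distinction on the
    residue combines them into one.\<close>
  have split: "c (t mod 3) i =
      (if t mod 3 = 0 then c 0 i else if t mod 3 = 1 then c 1 i else c 2 i)" for t i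
  proof -
    have "t mod 3 = 0 \<or> t mod 3 = 1 \<or> t mod 3 = 2" by presburger
    then show ?thesis by auto
  qed
  have dec: "dec_in Y (\<lambda>n. c (f n mod 3) (g n))" if "rec_in Y f" "rec_in Y g" for f g
    unfolding split
    by (intro dec_if dec_eq rec_mod3 rec_const that dec_comp[OF c]) simp_all
  have "re_in Y (\<lambda>m. ?G (p1 m) (entry (p2 m) (p1 m)) (entry (p2 m) (Suc (p1 m)))
      (entry (p2 m) (p1 m + 2)))"
    by (intro re_ex re_conj re_ball re_dec[OF dec_less] re_univ_eval X dec_not dec
        rec_add rec_Suc rec_entry rec_p1 rec_p2 rec_id rec_const)
  then show ?thesis using G by (rule rec_two_step[where G = ?G])
qed

subsection \<open>Limits in a closed set\<close>

text \<open>Consecutive terms agree on ever longer initial segments, so the sequence converges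
  pointwise, and closedness keeps the limit in \<open>C\<close>.\<close>

lemma cantor_closed_limit:
  assumes "cantor_closed C" and C: "\<And>k. s k \<in> C"
    and agree: "\<And>k. agree_upto (D k) (s k) (s (Suc k))" and D: "\<And>k. D k < D (Suc k)"
  shows "\<exists>c\<in>C. \<forall>k. agree_upto (D k) (s k) c"
proof -
  have mono: "strict_mono D" using D by (simp add: strict_mono_Suc_iff)
  have le: "n \<le> D n" for n by (rule strict_mono_imp_increasing[OF mono])
  have later: "agree_upto (D k) (s k) (s j)" if "k \<le> j" for k j
    using that
  proof (induction rule: dec_induct)
    case base
    show ?case by (simp add: agree_upto_def)
  next
    case (step j)
    have "D k \<le> D j" using mono step(1) by (simp add: strict_mono_less_eq)
    then show ?case using step.IH agree[of j] by (simp add: agree_upto_def)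
  qed
  \<comment> \<open>The bit at \<open>n\<close> is final from stage \<open>Suc n\<close> on, because
    \<open>n < D (Suc n)\<close>.\<close>
  define c where "c n = s (Suc n) n" for n
  have lim: "agree_upto (D k) (s k) c" for k
    unfolding agree_upto_def
  proof (intro allI impI)
    fix i assume i: "i < D k"
    show "s k i = c i"
    proof (cases "k \<le> Suc i")
      case True
      then show ?thesis using later i by (simp add: agree_upto_def c_def)
    next
      case False
      then have "agree_upto (D (Suc i)) (s (Suc i)) (s k)" by (intro later) simp
      then show ?thesis using le[of "Suc i"] by (simp add: agree_upto_def c_def)
    qed
  qed
  have "agree_upto n c (s n)" for n
    using lim[of n] le[of n] by (simp add: agree_upto_def)
  then have "c \<in> C" using assms(1) C unfolding cantor_closed_def by blast
  then show ?thesis using lim by blast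
qed

text \<open>Diagonalisation against an enumeration \<open>f\<close>: stage \<open>k\<close> moves to
  a nearby point of \<open>C\<close> if the current one is \<open>f k\<close>, then fixes a segment
  long enough to exclude \<open>f k\<close> from the limit.\<close>

lemma perfect_set_not_countable:
  assumes "perfect_set C" "countable T"
  shows "\<exists>y\<in>C. y \<notin> T"
proof -
  obtain f :: "nat \<Rightarrow> nat \<Rightarrow> bool" where f: "T \<subseteq> range f"
    using assms(2) by (metis countable_as_injective_image_subset range_from_nat_into_subset
        empty_subsetI range_from_nat_into order_refl)
  obtain a where a: "a \<in> C" using assms(1) by (auto simp: perfect_set_def)
  have "\<exists>\<sigma>. \<forall>k. fst (\<sigma> k) \<in> C \<and> (agree_upto (snd (\<sigma> k)) (fst (\<sigma> k)) (fst (\<sigma> (Suc k))) \<and>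
      snd (\<sigma> k) < snd (\<sigma> (Suc k)) \<and> \<not> agree_upto (snd (\<sigma> (Suc k))) (fst (\<sigma> (Suc k))) (f k))"
  proof (rule dependent_nat_choice)
    show "\<exists>\<sigma> :: (nat \<Rightarrow> bool) \<times> nat. fst \<sigma> \<in> C" using a by (intro exI[of _ "(a, 0)"]) simp
  next
    fix \<sigma> :: "(nat \<Rightarrow> bool) \<times> nat" and k
    assume \<sigma>: "fst \<sigma> \<in> C"
    obtain z where z: "z \<in> C" "agree_upto (snd \<sigma>) (fst \<sigma>) z" "z \<noteq> f k"
    proof (cases "fst \<sigma> = f k")
      case True
      then show ?thesis using assms(1) \<sigma> that unfolding perfect_set_def by metis
    next
      case False
      then show ?thesis using \<sigma> that[of "fst \<sigma>"] by (simp add: agree_upto_def)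
    qed
    then obtain i where "z i \<noteq> f k i" by blast
    then have "\<not> agree_upto (Suc (max i (snd \<sigma>))) z (f k)"
      unfolding agree_upto_def by (meson le_imp_less_Suc max.cobounded1)
    then show "\<exists>\<tau>. fst \<tau> \<in> C \<and> (agree_upto (snd \<sigma>) (fst \<sigma>) (fst \<tau>) \<and>
      snd \<sigma> < snd \<tau> \<and> \<not> agree_upto (snd \<tau>) (fst \<tau>) (f k))"
      using z by (intro exI[of _ "(z, Suc (max i (snd \<sigma>)))"]) auto
  qed
  then obtain \<sigma> where \<sigma>: "\<And>k. fst (\<sigma> k) \<in> C"
      "\<And>k. agree_upto (snd (\<sigma> k)) (fst (\<sigma> k)) (fst (\<sigma> (Suc k)))"
      "\<And>k. snd (\<sigma> k) < snd (\<sigma> (Suc k))"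
      "\<And>k. \<not> agree_upto (snd (\<sigma> (Suc k))) (fst (\<sigma> (Suc k))) (f k)"
    by blast
  have "cantor_closed C" using assms(1) by (simp add: perfect_set_def)
  from cantor_closed_limit[where s = "\<lambda>k. fst (\<sigma> k)" and D = "\<lambda>k. snd (\<sigma> k)", OF this \<sigma>(1-3)]
  obtain c where c: "c \<in> C" "\<And>k. agree_upto (snd (\<sigma> k)) (fst (\<sigma> k)) c" by blast
  have "c \<noteq> f k" for k using c(2)[of "Suc k"] \<sigma>(4)[of k] by blast
  then show ?thesis using c(1) f by blast
qed

subsection \<open>Coding\<close>

definition fdiff :: "(nat \<Rightarrow> bool) \<Rightarrow> (nat \<Rightarrow> bool) \<Rightarrow> nat" where
  "fdiff a b = (LEAST i. a i \<noteq> b i)"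

lemma fdiff: assumes "a \<noteq> b" shows "a (fdiff a b) \<noteq> b (fdiff a b)"
  unfolding fdiff_def by (rule LeastI_ex) (use assms in blast)

lemma agree_fdiff: "agree_upto (fdiff a b) a b"
  unfolding fdiff_def agree_upto_def using not_less_Least by blast

lemma le_fdiff: "a \<noteq> b \<Longrightarrow> agree_upto n a b \<Longrightarrow> n \<le> fdiff a b"
  using fdiff unfolding agree_upto_def by (metis not_le)

text \<open>Each of the finitely many indices that do not compute \<open>b\<close> fails at some
  position, by divergence or a wrong value; \<open>L\<close> exceeds one such position for
  each.\<close>

lemma ex_settling:
  "\<exists>L. \<forall>e\<le>n. (\<forall>i<L. univ_eval X e i (b i)) \<longrightarrow> (\<forall>i. univ_eval X e i (b i))"
proof -
  define g where "g e = (SOME i. \<not> univ_eval X e i (b i))" for e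
  have g: "\<forall>i. univ_eval X e i (b i)" if "univ_eval X e (g e) (b (g e))" for e
    using that unfolding g_def by (metis (mono_tags, lifting) someI)
  have "g e < Suc (\<Sum>e\<le>n. g e)" if "e \<le> n" for e
    using member_le_sum[of e "{..n}" g] that by (simp add: le_imp_less_Suc)
  then show ?thesis using g by blast
qed

text \<open>Disagreements can only be pushed beyond a bound, so the order of choice encodes
  \<open>v\<close>: the real that is to disagree first is chosen first, and the other one is pushed
  past it.\<close>

lemma ex_coded_pair:
  assumes B: "\<And>b n. b \<in> B \<Longrightarrow> \<exists>b'\<in>B. b' \<noteq> b \<and> agree_upto n b b'"
    and "a \<in> B" "b \<in> B"
  shows "\<exists>a'\<in>B. \<exists>b'\<in>B. a' \<noteq> a \<and> b' \<noteq> b \<and> m \<le> fdiff a a' \<and> n \<le> fdiff b b' \<and>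
    (v \<longleftrightarrow> fdiff a a' < fdiff b b')"
proof -
  have ext: "\<exists>b'\<in>B. b' \<noteq> b \<and> n \<le> fdiff b b'" if "b \<in> B" for b n
    using B[OF that] le_fdiff by metis
  show ?thesis
  proof (cases v)
    case True
    obtain a' where a': "a' \<in> B" "a' \<noteq> a" "m \<le> fdiff a a'" using ext assms by blast
    obtain b' where "b' \<in> B" "b' \<noteq> b" "max n (Suc (fdiff a a')) \<le> fdiff b b'"
      using ext assms by blast
    with a' True show ?thesis by (intro bexI[of _ a'] bexI[of _ b']) auto
  next
    case False
    obtain b' where b': "b' \<in> B" "b' \<noteq> b" "n \<le> fdiff b b'" using ext assms by blast
    obtain a' where "a' \<in> B" "a' \<noteq> a" "max m (fdiff b b') \<le> fdiff a a'"
      using ext assms by blast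
    with b' False show ?thesis by (intro bexI[of _ a'] bexI[of _ b']) auto
  qed
qed

text \<open>The last argument of \<open>G\<close> is the previous value \<open>d (t - 1)\<close>; for \<open>t = 0\<close> it is arbitrary.\<close>

definition grows :: "((nat \<Rightarrow> bool) \<Rightarrow> (nat \<Rightarrow> bool) \<Rightarrow> (nat \<Rightarrow> bool) \<Rightarrow> nat \<Rightarrow> nat) \<Rightarrow>
    (nat \<Rightarrow> nat \<Rightarrow> bool) \<Rightarrow> (nat \<Rightarrow> nat) \<Rightarrow> bool" where
  "grows G p d \<longleftrightarrow> (\<forall>t. p (t + 3) \<noteq> p t \<and> d t = fdiff (p t) (p (t + 3)) \<and>
     (\<exists>m. (\<forall>s. t = Suc s \<longrightarrow> m = d s) \<and> G (p t) (p (t + 1)) (p (t + 2)) m \<le> d t))"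

text \<open>Dependent choice on states that hold, for each system, a window of three consecutive
  targets and the previous disagreement. A transition drops the oldest target and appends its
  replacement.\<close>

lemma ex_coded_systems:
  assumes B: "\<And>b n. b \<in> B \<Longrightarrow> \<exists>b'\<in>B. b' \<noteq> b \<and> agree_upto n b b'" and "B \<noteq> {}"
  shows "\<exists>p q d d'. (\<forall>t. p t \<in> B) \<and> (\<forall>t. q t \<in> B) \<and> grows G p d \<and> grows G q d' \<and>
    (\<forall>t. y t \<longleftrightarrow> d t < d' t)"
proof -
  define R where "R n \<sigma> \<tau> = (case \<sigma> of ((a0, a1, a2, m), (b0, b1, b2, k)) \<Rightarrow>
      \<exists>a b. \<tau> = ((a1, a2, a, fdiff a0 a), (b1, b2, b, fdiff b0 b)) \<and> a \<noteq> a0 \<and> b \<noteq> b0 \<and>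
        G a0 a1 a2 m \<le> fdiff a0 a \<and> G b0 b1 b2 k \<le> fdiff b0 b \<and>
        (y n \<longleftrightarrow> fdiff a0 a < fdiff b0 b))" for n and \<sigma> \<tau> ::
      "((nat \<Rightarrow> bool) \<times> (nat \<Rightarrow> bool) \<times> (nat \<Rightarrow> bool) \<times> nat) \<times>
       ((nat \<Rightarrow> bool) \<times> (nat \<Rightarrow> bool) \<times> (nat \<Rightarrow> bool) \<times> nat)"
  let ?W = "B \<times> B \<times> B \<times> (UNIV :: nat set)"
  have "\<exists>\<sigma>. \<forall>n. \<sigma> n \<in> ?W \<times> ?W \<and> R n (\<sigma> n) (\<sigma> (Suc n))"
  proof (rule dependent_nat_choice)
    show "\<exists>\<sigma>. \<sigma> \<in> ?W \<times> ?W" using assms(2) by blast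
  next
    fix \<sigma> n assume "\<sigma> \<in> ?W \<times> ?W"
    then obtain a0 a1 a2 m b0 b1 b2 k where \<sigma>: "\<sigma> = ((a0, a1, a2, m), (b0, b1, b2, k))"
      and B': "a0 \<in> B" "a1 \<in> B" "a2 \<in> B" "b0 \<in> B" "b1 \<in> B" "b2 \<in> B" by blast
    from ex_coded_pair[OF B B'(1) B'(4)]
    obtain a b where "a \<in> B" "b \<in> B" "a \<noteq> a0" "b \<noteq> b0" "G a0 a1 a2 m \<le> fdiff a0 a"
      "G b0 b1 b2 k \<le> fdiff b0 b" "y n \<longleftrightarrow> fdiff a0 a < fdiff b0 b" by metis
    then show "\<exists>\<tau>. \<tau> \<in> ?W \<times> ?W \<and> R n \<sigma> \<tau>"
      using B' \<sigma> by (intro exI[of _ "((a1, a2, a, fdiff a0 a), (b1, b2, b, fdiff b0 b))"])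
        (simp add: R_def)
  qed
  then obtain \<sigma> where \<sigma>: "\<And>n. \<sigma> n \<in> ?W \<times> ?W" "\<And>n. R n (\<sigma> n) (\<sigma> (Suc n))" by blast
  define p q where "p n = fst (fst (\<sigma> n))" and "q n = fst (snd (\<sigma> n))" for n
  \<comment> \<open>The transition out of stage \<open>n\<close> stores its disagreement in stage
    \<open>Suc n\<close>, hence the shift.\<close>
  define d d' where "d n = snd (snd (snd (fst (\<sigma> (Suc n)))))"
    and "d' n = snd (snd (snd (snd (\<sigma> (Suc n)))))" for n
  have fst1: "fst (snd (fst (\<sigma> n))) = p (Suc n)" "fst (snd (snd (\<sigma> n))) = q (Suc n)" for n
    using \<sigma>(2)[of n] by (auto simp: R_def p_def q_def split: prod.splits)
  have fst2: "fst (snd (snd (fst (\<sigma> n)))) = p (Suc (Suc n))"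
    "fst (snd (snd (snd (\<sigma> n)))) = q (Suc (Suc n))" for n
    using \<sigma>(2)[of n] fst1[of "Suc n"] by (auto simp: R_def split: prod.splits)
  have eq: "\<sigma> n = ((p n, p (Suc n), p (Suc (Suc n)), snd (snd (snd (fst (\<sigma> n))))),
      (q n, q (Suc n), q (Suc (Suc n)), snd (snd (snd (snd (\<sigma> n))))))" for n
    using fst1[of n] fst2[of n] by (simp add: p_def q_def prod_eq_iff)
  have step: "R n (\<sigma> n) ((p (Suc n), p (Suc (Suc n)), p (n + 3), d n),
      (q (Suc n), q (Suc (Suc n)), q (n + 3), d' n))" for n
    using \<sigma>(2)[of n] eq[of "Suc n"] by (simp add: d_def d'_def numeral_3_eq_3)
  have main: "p (n + 3) \<noteq> p n \<and> q (n + 3) \<noteq> q n \<and> d n = fdiff (p n) (p (n + 3)) \<and>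
      d' n = fdiff (q n) (q (n + 3)) \<and>
      G (p n) (p (n + 1)) (p (n + 2)) (snd (snd (snd (fst (\<sigma> n))))) \<le> d n \<and>
      G (q n) (q (n + 1)) (q (n + 2)) (snd (snd (snd (snd (\<sigma> n))))) \<le> d' n \<and>
      (y n \<longleftrightarrow> d n < d' n)" for n
    using step[of n] by (subst (asm) eq) (simp add: R_def)
  have prev: "\<forall>s. n = Suc s \<longrightarrow> snd (snd (snd (fst (\<sigma> n)))) = d s"
    "\<forall>s. n = Suc s \<longrightarrow> snd (snd (snd (snd (\<sigma> n)))) = d' s" for n
    by (simp_all add: d_def d'_def)
  have "p n \<in> B" "q n \<in> B" for n
    using \<sigma>(1)[of n] by (auto simp: p_def q_def)
  moreover have "grows G p d"
    unfolding grows_def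
  proof
    fix t
    show "p (t + 3) \<noteq> p t \<and> d t = fdiff (p t) (p (t + 3)) \<and>
      (\<exists>m. (\<forall>s. t = Suc s \<longrightarrow> m = d s) \<and> G (p t) (p (t + 1)) (p (t + 2)) m \<le> d t)"
      using main[of t] prev(1)[of t]
      by (intro conjI exI[of _ "snd (snd (snd (fst (\<sigma> t))))"]) (elim conjE, assumption)+
  qed
  moreover have "grows G q d'"
    unfolding grows_def
  proof
    fix t
    show "q (t + 3) \<noteq> q t \<and> d' t = fdiff (q t) (q (t + 3)) \<and>
      (\<exists>m. (\<forall>s. t = Suc s \<longrightarrow> m = d' s) \<and> G (q t) (q (t + 1)) (q (t + 2)) m \<le> d' t)"
      using main[of t] prev(2)[of t]
      by (intro conjI exI[of _ "snd (snd (snd (snd (\<sigma> t))))"]) (elim conjE, assumption)+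
  qed
  moreover have "\<forall>t. y t \<longleftrightarrow> d t < d' t" using main by simp
  ultimately show ?thesis by blast
qed

text \<open>The summand with \<open>y\<close> keeps the limit of the targets different from \<open>y\<close>.\<close>

definition demand :: "(nat \<Rightarrow> bool) \<Rightarrow> (nat \<Rightarrow> bool) \<Rightarrow>
    (nat \<Rightarrow> bool) \<Rightarrow> (nat \<Rightarrow> bool) \<Rightarrow> (nat \<Rightarrow> bool) \<Rightarrow> nat \<Rightarrow> nat" where
  "demand X y a b c m = Suc (fdiff a y) + Suc m + (SOME e. \<forall>i. univ_eval X e i (c i)) +
     (SOME L. \<forall>e\<le>m. (\<forall>i<L. univ_eval X e i (b i)) \<longrightarrow> (\<forall>i. univ_eval X e i (b i)))"

text \<open>Each summand of \<open>demand\<close> supplies one property: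
  \<open>c r \<noteq> y\<close>, the growth of \<open>d\<close>, the bound on an index of
  \<open>p (t + 2)\<close>, and the settling of wrong indices. The reals \<open>c r\<close> are
  limits of targets along residue classes modulo 3.\<close>

lemma ex_tracks:
  assumes "cantor_closed C" "B \<subseteq> C" "y \<notin> B" and X: "\<And>b. b \<in> B \<Longrightarrow> turing_le b X"
    and p: "\<And>t. p t \<in> B" and gr: "grows (demand X y) p d"
  shows "\<exists>c. tracks X c p d \<and> (\<forall>r. c r \<in> C \<and> c r \<noteq> y)"
proof -
  have d: "d t = fdiff (p t) (p (t + 3))" "p t \<noteq> p (t + 3)" for t
    using gr unfolding grows_def by metis+
  have dem: "demand X y (p (Suc t)) (p (t + 2)) (p (t + 3)) (d t) \<le> d (Suc t)" for t
  proof -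
    have "\<exists>m. (\<forall>s. Suc t = Suc s \<longrightarrow> m = d s) \<and>
        demand X y (p (Suc t)) (p (Suc t + 1)) (p (Suc t + 2)) m \<le> d (Suc t)"
      using gr unfolding grows_def by blast
    then show ?thesis by (simp add: numeral_3_eq_3)
  qed
  \<comment> \<open>This form also covers stage 0, where \<open>m\<close> is arbitrary, and serves
    the summands that do not involve \<open>m\<close>.\<close>
  have dem': "\<exists>m. demand X y (p t) (p (t + 1)) (p (t + 2)) m \<le> d t" for t
    using gr unfolding grows_def by blast
  have inc: "d t < d (Suc t)" for t
    using dem[of t] by (simp add: demand_def)
  have y: "fdiff (p t) y < d t" for t
    using dem'[of t] by (auto simp: demand_def)
  have index: "\<exists>e\<le>d t. \<forall>i. univ_eval X e i (p (t + 2) i)" for t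
  proof -
    let ?e = "SOME e. \<forall>i. univ_eval X e i (p (t + 2) i)"
    have "\<forall>i. univ_eval X ?e i (p (t + 2) i)"
      using someI_ex[OF ex_univ_eval[OF X[OF p]]] .
    moreover have "?e \<le> d t" using dem'[of t] by (auto simp: demand_def)
    ultimately show ?thesis by blast
  qed
  have settled: "\<forall>e\<le>d t. (\<forall>i<d (Suc t). univ_eval X e i (p (t + 2) i)) \<longrightarrow> (\<forall>i. univ_eval X e i (p (t + 2) i))"
    for t
  proof -
    let ?P = "\<lambda>L. \<forall>e\<le>d t. (\<forall>i<L. univ_eval X e i (p (t + 2) i)) \<longrightarrow> (\<forall>i. univ_eval X e i (p (t + 2) i))"
    have "?P (SOME L. ?P L)" by (rule someI_ex[OF ex_settling])
    moreover have "(SOME L. ?P L) \<le> d (Suc t)" using dem[of t] by (simp add: demand_def)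
    ultimately show ?thesis by (meson order_less_le_trans)
  qed
  have inc3: "d t < d (t + 3)" for t
    using inc[of t] inc[of "Suc t"] inc[of "Suc (Suc t)"] by (simp add: numeral_3_eq_3)
  have "\<exists>c\<in>C. \<forall>k. agree_upto (d (r + 3 * k)) (p (r + 3 * k)) c" for r
  proof (rule cantor_closed_limit[OF assms(1)])
    show "p (r + 3 * k) \<in> C" for k using p assms(2) by blast
    show "agree_upto (d (r + 3 * k)) (p (r + 3 * k)) (p (r + 3 * Suc k))" for k
      using agree_fdiff d(1)[of "r + 3 * k"] by (simp add: add_ac)
    show "d (r + 3 * k) < d (r + 3 * Suc k)" for k
      using inc3[of "r + 3 * k"] by (simp add: add_ac)
  qed
  then obtain c where c: "\<And>r. c r \<in> C" "\<And>r k. agree_upto (d (r + 3 * k)) (p (r + 3 * k)) (c r)"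
    by metis
  have agree: "agree_upto (d t) (p t) (c (t mod 3))" for t
    using c(2)[of "t mod 3" "t div 3"] by simp
  have differ: "c (t mod 3) (d t) \<noteq> p t (d t)" for t
  proof -
    \<comment> \<open>At position \<open>d t\<close> the real already follows the next target in its
      class, which it does not leave before \<open>d (t + 3)\<close>.\<close>
    have "c (t mod 3) (d t) = p (t + 3) (d t)"
      using agree[of "t + 3"] inc3[of t] by (simp add: agree_upto_def)
    then show ?thesis using fdiff[OF d(2)[of t]] d(1)[of t] by simp
  qed
  have "c r \<noteq> y" for r
  proof -
    have "p r \<noteq> y" using p assms(3) by metis
    moreover have "p r (fdiff (p r) y) = c r (fdiff (p r) y)"
      using c(2)[of r 0] y[of r] by (simp add: agree_upto_def)
    ultimately show ?thesis using fdiff by metis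
  qed
  moreover have "tracks X c p d"
    unfolding tracks_def using agree differ inc index settled by blast
  ultimately show ?thesis using c(1) by blast
qed

text \<open>The join interleaves its members, so the bits of the \<open>i\<close>-th one stand at
  the positions congruent to \<open>i\<close> modulo the length.\<close>

lemma dec_in_join:
  assumes "a \<in> set as"
  shows "dec_in (join as) a"
proof -
  obtain i where i: "i < length as" "as ! i = a" using assms by (auto simp: in_set_conv_nth)
  have "join as (i + length as * n) = a n" for n
  proof -
    have "(i + length as * n) div length as = n"
      using i(1) by (subst div_mult_self2) auto
    then show ?thesis using i by (simp add: join_def)
  qed
  moreover have "dec_in (join as) (\<lambda>n. join as (i + length as * n))"
    by (intro dec_comp[OF dec_oracle] rec_add rec_mult rec_const rec_id)
  ultimately show ?thesis by simp
qed

theorem theorem1p3: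
  fixes A A' B :: "(nat \<Rightarrow> bool) set" and x :: "nat \<Rightarrow> bool"
  assumes "turing_independent A"
    and "A' \<subseteq> A" and "perfect_set A'"
    and "countable B" and "dense_in B A'"
    and "\<forall>b\<in>B. turing_le b x"
  shows "\<not> turing_independent ((A - B) \<union> {x})"
proof
  assume indep: "turing_independent ((A - B) \<union> {x})"
  have BA: "B \<subseteq> A'" and dense: "\<And>a n. a \<in> A' \<Longrightarrow> \<exists>b\<in>B. agree_upto n a b"
    using assms(5) by (auto simp: dense_in_def)
  have closed: "cantor_closed A'" using assms(3) by (simp add: perfect_set_def)
  have "A' \<noteq> {}" using assms(3) by (simp add: perfect_set_def)
  then have "B \<noteq> {}" using dense by blast
  \<comment> \<open>The set \<open>B\<close> inherits the lack of isolated points: approximate a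
    nearby point \<open>a\<close> of \<open>A'\<close> by an element of \<open>B\<close> beyond the
    first disagreement of \<open>a\<close> with \<open>b\<close>.\<close>
  have B: "\<exists>b'\<in>B. b' \<noteq> b \<and> agree_upto n b b'" if "b \<in> B" for b n
  proof -
    have "b \<in> A'" using BA that by blast
    moreover have "\<forall>b\<in>A'. \<forall>n. \<exists>a\<in>A'. a \<noteq> b \<and> agree_upto n b a"
      using assms(3) by (simp add: perfect_set_def)
    ultimately obtain a where a: "a \<in> A'" "a \<noteq> b" "agree_upto n b a" by metis
    obtain b' where b': "b' \<in> B" "agree_upto (max n (Suc (fdiff a b))) a b'"
      using dense[OF a(1)] by metis
    have "b' (fdiff a b) \<noteq> b (fdiff a b)"
      using b'(2) fdiff[OF a(2)] by (auto simp: agree_upto_def)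
    then have "b' \<noteq> b" by auto
    moreover have "agree_upto n b b'" using b'(2) a(3) by (simp add: agree_upto_def)
    ultimately show ?thesis using b'(1) by blast
  qed
  \<comment> \<open>As \<open>x\<close> is one of the joined reals, \<open>y\<close> must differ
    from it; avoiding \<open>B\<close> puts \<open>y\<close> into \<open>A - B\<close>.\<close>
  obtain y where y: "y \<in> A'" "y \<notin> B" "y \<noteq> x"
    using perfect_set_not_countable[OF assms(3), of "insert x B"] assms(4) by auto
  from ex_coded_systems[where G = "demand x y" and y = y, OF B \<open>B \<noteq> {}\<close>]
  obtain p q d d' where p: "\<And>t. p t \<in> B" "grows (demand x y) p d"
    and q: "\<And>t. q t \<in> B" "grows (demand x y) q d'" and code: "\<And>t. y t \<longleftrightarrow> d t < d' t"
    by blast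
  obtain c where c: "tracks x c p d" "\<And>r. c r \<in> A'" "\<And>r. c r \<noteq> y"
    using ex_tracks[OF closed BA y(2) _ p] assms(6) by metis
  obtain c' where c': "tracks x c' q d'" "\<And>r. c' r \<in> A'" "\<And>r. c' r \<noteq> y"
    using ex_tracks[OF closed BA y(2) _ q] assms(6) by metis
  \<comment> \<open>Coding reals that happen to lie in \<open>B\<close> are computable from \<open>x\<close> and can be omitted.\<close>
  define as where "as = x # filter (\<lambda>a. a \<notin> B) (map c [0..<3] @ map c' [0..<3])"
  have x: "dec_in (join as) x" by (rule dec_in_join) (simp add: as_def)
  have dec: "dec_in (join as) a" if "a \<in> B \<or> a \<in> set as" for a
    using that dec_in_join dec_in_trans[OF _ x] assms(6) by blast
  have "rec_in (join as) d"
    by (rule rec_tracks[OF c(1) x], rule dec) (auto simp: as_def)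
  moreover have "rec_in (join as) d'"
    by (rule rec_tracks[OF c'(1) x], rule dec) (auto simp: as_def)
  ultimately have "dec_in (join as) (\<lambda>t. d t < d' t)" by (rule dec_less)
  then have "turing_le y (join as)" by (simp add: turing_le_iff_dec_in code[symmetric])
  moreover have "as \<noteq> []" "set as \<subseteq> (A - B) \<union> {x}" "y \<notin> set as" "y \<in> (A - B) \<union> {x}"
    using c(2,3) c'(2,3) y assms(2) by (auto simp: as_def)
  ultimately show False using indep unfolding turing_independent_def by blast
qed

end
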